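(* Let $0<\alpha\le1\le L$, let $\kappa=L/\alpha$, and let $f:\mathbb{R}^d\to\mathbb{R}$ be $\alpha$-strongly convex and $L$-smooth with minimizer $x^*$. Let $\varepsilon>0$. Run the algorithm RHGD with stepsize $h=\frac{1}{4\sqrt L}$ and refreshment rate $\gamma_k=\sqrt\alpha$ for all $k$, from any $x_0\in\mathbb{R}^d$ (and $y_0=0$). If the number of iterations $K$ satisfies $$K\ge(24\sqrt\kappa+1)\cdot\log\left(\frac{\mathbb{E}\left[f(x_0)-f(x^* )+\frac{\alpha}{72}\|x_0-x^*\|^2\right]}{\varepsilon}\right),$$ then $\mathbb{E}[f(x_K)-f(x^* )]\le\varepsilon$.
   Context: $\|\cdot\|$ is the Euclidean norm. A differentiable $f$ is $\alpha$-strongly convex if $f(y)\ge f(x)+\langle\nabla f(x),y-x\rangle+\frac{\alpha}{2}\|y-x\|^2$ for all $x,y$, and $L$-smooth if $\|\nabla f(x)-\nabla f(y)\|\le L\|x-y\|$ for all $x,y$. Randomized Hamiltonian gradient descent (RHGD) with stepsize $h>0$ and refreshment rates $\gamma_k>0$: from $x_0\in\mathbb{R}^d$ and $y_0=0$, for $k=0,1,2,\dots$ set $x_{k+\frac12}=x_k+hy_k$; $x_{k+1}=x_{k+\frac12}-h^2\nabla f(x_{k+\frac12})$; $\tilde y_{k+1}=y_k-h\nabla f(x_{k+1})$; $y_{k+1}=\tilde y_{k+1}$ with probability $1-\min(\gamma_kh,1)$ and $y_{k+1}=0$ with probability $\min(\gamma_kh,1)$, the random choice at each iteration being independent of the past.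 Expectations are over these random choices (for deterministic $x_0$ the expectation of functions of $x_0$ is trivial). *)

theory Defs
  imports "HOL-Probability.Probability"
begin

definition grad :: "('a::euclidean_space \<Rightarrow> real) \<Rightarrow> 'a \<Rightarrow> 'a" where
  "grad f x = (THE D. GDERIV f x :> D)"

lemma GDERIV_grad:
  fixes f :: "'a::euclidean_space \<Rightarrow> real"
  assumes "f differentiable at x"
  shows "GDERIV f x :> grad f x"
proof -
  obtain f' where f': "(f has_derivative f') (at x)"
    using assms by (auto simp: differentiable_def)
  interpret bounded_linear f'
    using f' by (rule has_derivative_bounded_linear)
  define D where "D = adjoint f' 1"
  have "f' h = h \<bullet> D" for h
    using adjoint_works[OF linear_axioms, of h 1] by (simp add: D_def)
  then have "f' = (\<lambda>h. h \<bullet> D)"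
    by (rule ext)
  with f' have D: "GDERIV f x :> D"
    by (simp add: gderiv_def)
  have "D' = D" if "GDERIV f x :> D'" for D'
  proof -
    have "(\<lambda>h. h \<bullet> D') = (\<lambda>h. h \<bullet> D)"
      using that D unfolding gderiv_def by (rule has_derivative_unique)
    then have "(D' - D) \<bullet> (D' - D) = 0"
      by (metis inner_diff_right right_minus_eq)
    then show ?thesis
      by simp
  qed
  with D show ?thesis
    unfolding grad_def by (rule theI)
qed

definition strongly_convex :: "real \<Rightarrow> ('a::euclidean_space \<Rightarrow> real) \<Rightarrow> bool" where
  "strongly_convex \<alpha> f \<longleftrightarrow> (\<forall>x. f differentiable at x) \<and>
     (\<forall>x y. f y \<ge> f x + grad f x \<bullet> (y - x) + \<alpha> / 2 * (norm (y - x))\<^sup>2)"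

definition L_smooth :: "real \<Rightarrow> ('a::euclidean_space \<Rightarrow> real) \<Rightarrow> bool" where
  "L_smooth L f \<longleftrightarrow> (\<forall>x. f differentiable at x) \<and>
     (\<forall>x y. norm (grad f x - grad f y) \<le> L * norm (x - y))"

(* One iteration of randomized Hamiltonian gradient descent with stepsize h and
   refreshment rate g. The coin is drawn afresh, hence independently of the past. *)
definition rhgd_step ::
  "('a::euclidean_space \<Rightarrow> real) \<Rightarrow> real \<Rightarrow> real \<Rightarrow> 'a \<times> 'a \<Rightarrow> ('a \<times> 'a) pmf" where
  "rhgd_step f h g = (\<lambda>(x, y).
     let x_half = x + h *\<^sub>R y;
         x_new = x_half - h\<^sup>2 *\<^sub>R grad f x_half;
         y_tilde = y - h *\<^sub>R grad f x_new
     in bind_pmf (bernoulli_pmf (min (g * h) 1))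
          (\<lambda>refresh. return_pmf (x_new, if refresh then 0 else y_tilde)))"

(* The joint law of the k-th iterate (x_k, y_k), started from (x0, 0). All these laws
   have finite support, so every expectation over them is a genuine (finite) one. *)
primrec rhgd ::
  "('a::euclidean_space \<Rightarrow> real) \<Rightarrow> real \<Rightarrow> (nat \<Rightarrow> real) \<Rightarrow> 'a \<Rightarrow> nat \<Rightarrow> ('a \<times> 'a) pmf" where
  "rhgd f h \<gamma> x0 0 = return_pmf (x0, 0)"
| "rhgd f h \<gamma> x0 (Suc k) = bind_pmf (rhgd f h \<gamma> x0 k) (rhgd_step f h (\<gamma> k))"

end

theory Submission
  imports Defs
begin

text \<open>
  The proof is a Lyapunov argument. In continuous time the dynamics is the Hamiltonian flow
  \<open>dx/dt = y\<close>, \<open>dy/dt = - grad f x\<close>, with the velocity reset to zero at rate \<open>sqrt \<alpha>\<close>. The flow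
  preserves \<open>f x + \<bar>y\<bar>\<^sup>2 / 2\<close> and the resets only lose kinetic energy, but that sum does not
  contract: nothing in its drift controls the potential energy. The remedy is the cross term in
  \<open>f x - f xstar + \<alpha> / 72 * \<bar>x - xstar + (6 / sqrt \<alpha>) y\<bar>\<^sup>2\<close>,
  whose kinetic part is still \<open>\<bar>y\<bar>\<^sup>2 / 2\<close>. Differentiating the cross term along the flow
  produces a multiple of \<open>- (x - xstar) \<bullet> grad f x\<close>, which by strong convexity is at most the same multiple of
  \<open>- (f x - f xstar) - \<alpha> / 2 * \<bar>x - xstar\<bar>\<^sup>2\<close>; the \<open>\<bar>y\<bar>\<^sup>2\<close> that it also produces is absorbed by
  the kinetic energy lost in the resets.

  The discrete step is implicit Euler for this flow up to a small error. Indeed, with \<open>x'\<close> and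
  \<open>y'\<close> the new position and velocity before the reset,
  \<open>y' = y - h * grad f x'\<close> and \<open>x' = x + h * y' + h\<^sup>2 * (grad f x' - grad f x_half)\<close>. Smoothness and
  \<open>L * h\<^sup>2 = 1 / 16\<close> bound the gradient difference by \<open>1 / 15\<close> of \<open>grad f x'\<close>, and implicit Euler
  dissipates \<open>h\<^sup>2 / 2 * \<bar>grad f x'\<bar>\<^sup>2\<close>, which together with the slack in the
  continuous estimate pays for the discretization errors. Expanding
  the old energy around the new point therefore gives a contraction by the factor
  \<open>1 / (1 + p / 6)\<close>, where \<open>p = sqrt \<alpha> * h\<close> is the reset probability
  (\<open>energy_contraction\<close>). Since \<open>6 / p = 24 * sqrt \<kappa>\<close>, this factor is
  \<open>1 - 1 / (24 * sqrt \<kappa> + 1) \<le> exp (- 1 / (24 * sqrt \<kappa> + 1))\<close>. The energy dominates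
  \<open>f x - f xstar\<close>, and at \<open>y = 0\<close> it is the quantity that the logarithm compares with \<open>\<epsilon>\<close>.
\<close>

text \<open>
  The one-step contraction in dimensionless variables:
  \<open>Z = sqrt \<alpha> (x' - xstar)\<close>, \<open>Y = y'\<close>, \<open>G = h grad f x'\<close>, \<open>D = h (grad f x' - grad f x_half)\<close> and
  \<open>F = f x' - f xstar\<close>, for the new position \<open>x'\<close> and velocity \<open>y'\<close>. The hypothesis on \<open>F\<close> is strong
  convexity between \<open>x'\<close> and \<open>xstar\<close>; the term \<open>F - G \<bullet> Y - G \<bullet> D\<close> is the convexity lower
  bound for the old function gap.
\<close>

lemma scaled_energy_inequality:
  fixes Z Y G D :: "'a::real_inner" and p F :: real
  assumes p: "0 \<le> p" "p \<le> 1 / 4"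
    and D: "15 * norm D \<le> norm G"
    and F: "p * F \<le> Z \<bullet> G - p / 2 * (norm Z)\<^sup>2"
  shows "(1 + p / 6) * (F + (1 - p) / 72 * (norm (Z + 6 *\<^sub>R Y))\<^sup>2 + p / 72 * (norm Z)\<^sup>2)
    \<le> F - G \<bullet> Y - G \<bullet> D + 1 / 72 * (norm (Z - p *\<^sub>R Y - p *\<^sub>R D + 6 *\<^sub>R (Y + G)))\<^sup>2"
proof -
  have young: "2 * \<bar>u \<bullet> v\<bar> \<le> u \<bullet> u + v \<bullet> v" for u v :: 'a
  proof -
    have "0 \<le> (u + v) \<bullet> (u + v)" "0 \<le> (u - v) \<bullet> (u - v)"
      by simp_all
    then show ?thesis
      by (simp add: inner_simps inner_commute)
  qed
  have GD: "15 * \<bar>G \<bullet> D\<bar> \<le> G \<bullet> G"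
  proof -
    have "15 * \<bar>G \<bullet> D\<bar> \<le> norm G * (15 * norm D)"
      using Cauchy_Schwarz_ineq2[of G D] by simp
    also have "\<dots> \<le> norm G * norm G"
      using D by (intro mult_left_mono) auto
    finally show ?thesis
      by (simp add: dot_square_norm power2_eq_square)
  qed
  have DD: "225 * (D \<bullet> D) \<le> G \<bullet> G"
  proof -
    have "(15 * norm D)\<^sup>2 \<le> (norm G)\<^sup>2"
      using D by (intro power_mono) auto
    then show ?thesis
      by (simp add: power_mult_distrib dot_square_norm)
  qed
  define R where "R = 35 / 432 * (Z \<bullet> Z) + (1 / 4 + 7 * p / 72) * (Y \<bullet> Y)
    + (1 / 9 + p / 36) * (Z \<bullet> Y) - (Y \<bullet> G + Y \<bullet> D + G \<bullet> D) / 6 + p / 72 * (D \<bullet> D)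
    - Z \<bullet> D / 36 + p / 36 * (Y \<bullet> D)"
  have R: "R \<ge> - (G \<bullet> G)"
  proof -
    have a: "p * \<bar>Y \<bullet> D\<bar> \<le> 1 / 4 * \<bar>Y \<bullet> D\<bar>" "p * \<bar>Z \<bullet> Y\<bar> \<le> 1 / 4 * \<bar>Z \<bullet> Y\<bar>"
      using p by (intro mult_right_mono; simp)+
    have b: "p * (Y \<bullet> D) \<ge> - (p * \<bar>Y \<bullet> D\<bar>)" "p * (Z \<bullet> Y) \<ge> - (p * \<bar>Z \<bullet> Y\<bar>)"
      using p by (auto simp: abs_if)
    have c: "p * (Y \<bullet> Y) \<ge> 0" "p * (D \<bullet> D) \<ge> 0" "Y \<bullet> Y \<ge> 0" "Z \<bullet> Z \<ge> 0"
      using p by simp_all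
    show ?thesis
      unfolding R_def using a b c young[of Z Y] young[of Y G] young[of Y D] young[of Z D] GD DD
      by (simp add: algebra_simps) argo
  qed
  \<comment> \<open>Apart from the slack in the strong convexity hypothesis, only the dissipation \<open>G \<bullet> G / 2\<close> and the
    error \<open>G \<bullet> D\<close> lack the factor \<open>p \<le> 1 / 4\<close>, so a crude bound on \<open>R\<close> is enough.\<close>
  have expand: "F - G \<bullet> Y - G \<bullet> D + 1 / 72 * (norm (Z - p *\<^sub>R Y - p *\<^sub>R D + 6 *\<^sub>R (Y + G)))\<^sup>2
     - (1 + p / 6) * (F + (1 - p) / 72 * (norm (Z + 6 *\<^sub>R Y))\<^sup>2 + p / 72 * (norm Z)\<^sup>2)
    = (Z \<bullet> G - p / 2 * (norm Z)\<^sup>2 - p * F) / 6 + G \<bullet> G / 2 - G \<bullet> D + p * R"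
    unfolding R_def power2_norm_eq_inner
    by (simp add: inner_simps inner_commute field_simps power2_eq_square)
  have "p * R \<ge> p * (- (G \<bullet> G))"
    using R p by (intro mult_left_mono) auto
  moreover have "p * (G \<bullet> G) \<le> 1 / 4 * (G \<bullet> G)"
    using p by (intro mult_right_mono) auto
  ultimately show ?thesis
    using expand F GD inner_ge_zero[of G] by argo
qed

definition energy :: "real \<Rightarrow> ('a::real_inner \<Rightarrow> real) \<Rightarrow> 'a \<Rightarrow> 'a \<times> 'a \<Rightarrow> real" where
  "energy \<alpha> f xstar = (\<lambda>(x, y).
     f x - f xstar + \<alpha> / 72 * (norm (x - xstar + (6 / sqrt \<alpha>) *\<^sub>R y))\<^sup>2)"

lemma energy_scaled:
  assumes "0 < \<alpha>"
  shows "energy \<alpha> f xstar (x, y)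
    = f x - f xstar + 1 / 72 * (norm (sqrt \<alpha> *\<^sub>R (x - xstar) + 6 *\<^sub>R y))\<^sup>2"
proof -
  have "sqrt \<alpha> *\<^sub>R (x - xstar) + 6 *\<^sub>R y = sqrt \<alpha> *\<^sub>R (x - xstar + (6 / sqrt \<alpha>) *\<^sub>R y)"
    using assms by (simp add: scaleR_add_right)
  then show ?thesis
    using assms by (simp add: energy_def power_mult_distrib)
qed

text \<open>
  The final gradient descent move has step \<open>s\<close> with \<open>L * s\<close> small, so it changes the gradient only by a small
  fraction. Measuring the change against the gradient at the end point, which is the one
  that implicit Euler uses, turns \<open>1 / 16\<close> into \<open>1 / 15\<close>.
\<close>

lemma gradient_change_along_descent_step:
  assumes "L_smooth L f" and "0 \<le> s" and "L * s = 1 / 16"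
  shows "15 * norm (grad f (x - s *\<^sub>R grad f x) - grad f x) \<le> norm (grad f (x - s *\<^sub>R grad f x))"
proof -
  let ?g = "grad f x" and ?g' = "grad f (x - s *\<^sub>R grad f x)"
  have "norm (?g' - ?g) \<le> L * norm (x - s *\<^sub>R ?g - x)"
    using assms(1) unfolding L_smooth_def by blast
  also have "\<dots> = (L * s) * norm ?g"
    using assms(2) by simp
  finally have "16 * norm (?g' - ?g) \<le> norm ?g"
    using assms(3) by simp
  moreover have "norm ?g \<le> norm ?g' + norm (?g' - ?g)"
    by (metis norm_triangle_sub norm_minus_commute)
  ultimately show ?thesis
    by linarith
qed

text \<open>
  Rewriting the old state through the new one makes the step an instance of the dimensionless
  inequality; averaging over the coin supplies the weights \<open>p\<close> and \<open>1 - p\<close> there.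
\<close>

lemma energy_contraction:
  fixes f :: "'a::euclidean_space \<Rightarrow> real"
  assumes \<alpha>: "0 < \<alpha>" and h: "0 < h" "sqrt \<alpha> * h \<le> 1 / 4" "L * h\<^sup>2 = 1 / 16"
    and convex: "strongly_convex \<alpha> f" and smooth: "L_smooth L f"
  shows "measure_pmf.expectation (rhgd_step f h (sqrt \<alpha>) s) (energy \<alpha> f xstar)
    \<le> energy \<alpha> f xstar s / (1 + sqrt \<alpha> * h / 6)"
proof -
  obtain x y where s: "s = (x, y)"
    by (cases s)
  define p where "p = sqrt \<alpha> * h"
  define x_half where "x_half = x + h *\<^sub>R y"
  define x' where "x' = x_half - h\<^sup>2 *\<^sub>R grad f x_half"
  define y' where "y' = y - h *\<^sub>R grad f x'"
  define D where "D = grad f x' - grad f x_half"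
  have p: "0 < p" "p \<le> 1 / 4"
    using \<alpha> h by (simp_all add: p_def)
  have convexD: "f v \<ge> f u + grad f u \<bullet> (v - u) + \<alpha> / 2 * (norm (v - u))\<^sup>2" for u v
    using convex by (simp add: strongly_convex_def)
  have D: "15 * norm D \<le> norm (grad f x')"
    unfolding D_def x'_def
    using gradient_change_along_descent_step[OF smooth _ h(3)] by simp
  \<comment> \<open>Old state in terms of the new one: the form in which the step is a perturbed implicit Euler step.\<close>
  have old_x: "x - x' = - (h *\<^sub>R y') - h\<^sup>2 *\<^sub>R D"
    by (simp add: D_def y'_def x'_def x_half_def algebra_simps power2_eq_square)
  have old_y: "y = y' + h *\<^sub>R grad f x'"
    by (simp add: y'_def)
  have "(1 + p / 6) * (f x' - f xstar + (1 - p) / 72 * (norm (sqrt \<alpha> *\<^sub>R (x' - xstar) + 6 *\<^sub>R y'))\<^sup>2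
      + p / 72 * (norm (sqrt \<alpha> *\<^sub>R (x' - xstar)))\<^sup>2)
    \<le> f x' - f xstar - (h *\<^sub>R grad f x') \<bullet> y' - (h *\<^sub>R grad f x') \<bullet> (h *\<^sub>R D)
      + 1 / 72 * (norm (sqrt \<alpha> *\<^sub>R (x' - xstar) - p *\<^sub>R y' - p *\<^sub>R (h *\<^sub>R D)
          + 6 *\<^sub>R (y' + h *\<^sub>R grad f x')))\<^sup>2"
  proof (rule scaled_energy_inequality)
    show "0 \<le> p" "p \<le> 1 / 4"
      using p by simp_all
    show "15 * norm (h *\<^sub>R D) \<le> norm (h *\<^sub>R grad f x')"
      using D h(1) by simp
    have "f x' - f xstar \<le> (x' - xstar) \<bullet> grad f x' - \<alpha> / 2 * (norm (x' - xstar))\<^sup>2"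
      using convexD[of x' xstar]
      by (simp add: inner_diff_right inner_diff_left norm_minus_commute inner_commute)
    then have "p * (f x' - f xstar)
        \<le> p * ((x' - xstar) \<bullet> grad f x' - \<alpha> / 2 * (norm (x' - xstar))\<^sup>2)"
      using p by (intro mult_left_mono) auto
    then show "p * (f x' - f xstar) \<le> (sqrt \<alpha> *\<^sub>R (x' - xstar)) \<bullet> (h *\<^sub>R grad f x')
        - p / 2 * (norm (sqrt \<alpha> *\<^sub>R (x' - xstar)))\<^sup>2"
      using \<alpha> by (simp add: p_def power_mult_distrib right_diff_distrib mult_ac
          flip: scaleR_diff_right)
  qed
  also have "\<dots> \<le> energy \<alpha> f xstar (x, y)"
  proof -
    have "f x \<ge> f x' + grad f x' \<bullet> (x - x') + \<alpha> / 2 * (norm (x - x'))\<^sup>2"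
      by (rule convexD)
    moreover have "\<alpha> / 2 * (norm (x - x'))\<^sup>2 \<ge> 0"
      using \<alpha> by simp
    ultimately have "f x \<ge> f x' - (h *\<^sub>R grad f x') \<bullet> y' - (h *\<^sub>R grad f x') \<bullet> (h *\<^sub>R D)"
      unfolding old_x by (simp add: inner_diff_right power2_eq_square)
    moreover have "sqrt \<alpha> *\<^sub>R (x - xstar)
        = sqrt \<alpha> *\<^sub>R (x' - xstar) - p *\<^sub>R y' - p *\<^sub>R (h *\<^sub>R D)"
    proof -
      have "x - xstar = (x' - xstar) + (x - x')"
        by simp
      then show ?thesis
        unfolding old_x p_def by (simp only:) (simp add: algebra_simps power2_eq_square)
    qed
    ultimately show ?thesis
      unfolding energy_scaled[OF \<alpha>] by (simp flip: old_y)
  qed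
  finally have "(1 + p / 6) * (p * energy \<alpha> f xstar (x', 0) + (1 - p) * energy \<alpha> f xstar (x', y'))
      \<le> energy \<alpha> f xstar s"
    unfolding energy_scaled[OF \<alpha>] s by (simp add: algebra_simps)
  moreover have "measure_pmf.expectation (rhgd_step f h (sqrt \<alpha>) s) (energy \<alpha> f xstar)
      = p * energy \<alpha> f xstar (x', 0) + (1 - p) * energy \<alpha> f xstar (x', y')"
  proof -
    have "rhgd_step f h (sqrt \<alpha>) s = map_pmf (\<lambda>refresh. (x', if refresh then 0 else y')) (bernoulli_pmf p)"
      using p by (simp add: rhgd_step_def s map_pmf_def Let_def p_def x_half_def x'_def y'_def
          cong: if_cong)
    then show ?thesis
      using p by simp
  qed
  moreover have "0 < 1 + p / 6"
    using p by simp
  ultimately show ?thesis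
    unfolding p_def[symmetric] by (simp add: pos_le_divide_eq mult.commute)
qed

lemma finite_set_pmf_rhgd_step: "finite (set_pmf (rhgd_step f h g s))"
  by (simp add: rhgd_step_def Let_def split: prod.split)

lemma finite_set_pmf_rhgd: "finite (set_pmf (rhgd f h \<gamma> x0 k))"
  by (induction k) (simp_all add: finite_set_pmf_rhgd_step)

text \<open>
  Conditioning on the current state, the next coin is fresh, so a contraction from every fixed
  state passes to the law of the whole chain.
\<close>

lemma rhgd_expectation_geometric:
  fixes V :: "'a::euclidean_space \<times> 'a \<Rightarrow> real"
  assumes step: "\<And>k s. measure_pmf.expectation (rhgd_step f h (\<gamma> k) s) V \<le> r * V s"
    and r: "0 \<le> r"
  shows "measure_pmf.expectation (rhgd f h \<gamma> x0 k) V \<le> r ^ k * V (x0, 0)"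
proof (induction k)
  case 0
  then show ?case
    by simp
next
  case (Suc k)
  let ?M = "rhgd f h \<gamma> x0 k"
  have "measure_pmf.expectation (rhgd f h \<gamma> x0 (Suc k)) V
      = (\<Sum>s\<in>set_pmf ?M. pmf ?M s *\<^sub>R measure_pmf.expectation (rhgd_step f h (\<gamma> k) s) V)"
    unfolding rhgd.simps
    by (rule pmf_expectation_bind) (simp_all add: finite_set_pmf_rhgd finite_set_pmf_rhgd_step)
  also have "\<dots> \<le> (\<Sum>s\<in>set_pmf ?M. pmf ?M s *\<^sub>R (r * V s))"
    by (intro sum_mono scaleR_left_mono step) simp
  also have "\<dots> = r * measure_pmf.expectation ?M V"
    by (subst integral_measure_pmf[OF finite_set_pmf_rhgd])
       (auto simp: sum_distrib_left algebra_simps)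
  also have "\<dots> \<le> r * (r ^ k * V (x0, 0))"
    by (intro mult_left_mono Suc r)
  finally show ?case
    by simp
qed

lemma power_contraction_le:
  fixes N c \<epsilon> :: real
  assumes N: "1 \<le> N" and c: "0 \<le> c" and \<epsilon>: "0 < \<epsilon>" and K: "N * ln (c / \<epsilon>) \<le> real K"
  shows "(1 - 1 / N) ^ K * c \<le> \<epsilon>"
proof (cases "c = 0")
  case True
  then show ?thesis
    using \<epsilon> by simp
next
  case False
  then have c: "0 < c"
    using c by simp
  have "(1 - 1 / N) ^ K \<le> exp (- 1 / N) ^ K"
    using N exp_ge_add_one_self[of "- 1 / N"] by (intro power_mono) simp_all
  also have "\<dots> = exp (- (real K / N))"
    by (simp flip: exp_of_nat_mult)
  also have "\<dots> \<le> exp (- ln (c / \<epsilon>))"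
    using N K by (simp add: field_simps)
  also have "\<dots> = \<epsilon> / c"
    using c \<epsilon> by (simp add: exp_minus)
  finally show ?thesis
    using c by (simp add: field_simps)
qed

theorem corollary1:
  fixes f :: "'a::euclidean_space \<Rightarrow> real"
    and xstar x0 :: 'a
    and \<alpha> L \<kappa> \<epsilon> h :: real
    and \<gamma> :: "nat \<Rightarrow> real"
    and K :: nat
  assumes "0 < \<alpha>" and "\<alpha> \<le> 1" and "1 \<le> L"
    and "\<kappa> = L / \<alpha>"
    and "strongly_convex \<alpha> f" and "L_smooth L f"
    and "\<forall>x. f xstar \<le> f x"
    and "0 < \<epsilon>"
    and "h = 1 / (4 * sqrt L)"
    and "\<forall>k. \<gamma> k = sqrt \<alpha>"
    and "real K \<ge> (24 * sqrt \<kappa> + 1) *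
           ln (measure_pmf.expectation (rhgd f h \<gamma> x0 0)
                 (\<lambda>(x, y). f x - f xstar + \<alpha> / 72 * (norm (x - xstar))\<^sup>2) / \<epsilon>)"
  shows "measure_pmf.expectation (rhgd f h \<gamma> x0 K) (\<lambda>(x, y). f x - f xstar) \<le> \<epsilon>"
proof -
  let ?V = "energy \<alpha> f xstar" and ?N = "24 * sqrt \<kappa> + 1"
  have sqrts: "0 < sqrt \<alpha>" "sqrt \<alpha> \<le> 1" "1 \<le> sqrt L"
    using assms(1-3) by simp_all
  have h: "0 < h" "sqrt \<alpha> * h \<le> 1 / 4" "L * h\<^sup>2 = 1 / 16"
    using assms(3) sqrts by (simp_all add: assms(9) field_simps)
  have N: "1 \<le> ?N"
    using assms(1,3,4) by simp
  have factor: "1 / (1 + sqrt \<alpha> * h / 6) = 1 - 1 / ?N"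
  proof -
    have "?N = 1 + 24 * sqrt L / sqrt \<alpha>" "sqrt \<alpha> * h / 6 = sqrt \<alpha> / (24 * sqrt L)"
      by (simp_all add: assms(4,9) real_sqrt_divide)
    moreover have "1 / (1 + a / (24 * b)) = 1 - 1 / (1 + 24 * b / a)" if "0 < a" "0 < b" for a b :: real
    proof -
      have "a + 24 * b \<noteq> 0"
        using that by linarith
      then show ?thesis
        using that by (simp add: divide_simps)
    qed
    ultimately show ?thesis
      using sqrts by simp
  qed
  have "measure_pmf.expectation (rhgd_step f h (\<gamma> k) s) ?V \<le> (1 - 1 / ?N) * ?V s" for k s
    using energy_contraction[OF assms(1) h assms(5,6), of s xstar] assms(10)
    by (simp flip: factor)
  then have decay: "measure_pmf.expectation (rhgd f h \<gamma> x0 K) ?V \<le> (1 - 1 / ?N) ^ K * ?V (x0, 0)"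
  proof (rule rhgd_expectation_geometric)
    show "0 \<le> 1 - 1 / ?N"
      using N by (simp only: diff_ge_0_iff_ge divide_le_eq_1) argo
  qed
  have "measure_pmf.expectation (rhgd f h \<gamma> x0 K) (\<lambda>(x, y). f x - f xstar)
      \<le> measure_pmf.expectation (rhgd f h \<gamma> x0 K) ?V"
    using assms(1)
    by (intro integral_mono integrable_measure_pmf_finite finite_set_pmf_rhgd)
       (auto simp: energy_def)
  also note decay
  also have "(1 - 1 / ?N) ^ K * ?V (x0, 0) \<le> \<epsilon>"
    using assms(1,7,8,11) by (intro power_contraction_le N) (simp_all add: energy_def)
  finally show ?thesis .
qed

end
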